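(* Let $n\ge 3$. In the asynchronous read-write shared memory model with $n$ processes, no algorithm implements conflict-obstruction-free (binary) consensus; that is, no algorithm satisfies Validity, Agreement and COF Termination.
   Context: **Model.** There are $n$ asynchronous deterministic processes communicating through atomic read-write registers. Any number of processes may crash (stop taking steps); there are no timing or fairness assumptions. An algorithm consists of one deterministic automaton per process. Each step of a process consists of local computation and one shared-memory event (a read or a write of one register), after which the process updates its local state and possibly returns a response to its pending operation. A configuration consists of the local states of all processes and the contents of all registers. An execution is a finite or infinite sequence of steps of the processes, following their automata, from an initial configuration. **Consensus.** Each process invokes a single-shot operation $\textit{propose}(v)$ with an input $v\in\{0,1\}$ and decides the value returned. An initial configuration is determined by the vector of inputs of the processes; the algorithm must work for every input vector. A process takes steps only until its $\textit{propose}$ operation returns. **Correct processes.** In an infinite execution a process is correct if it takes infinitely many steps or has no pending operation. **COF consensus** requires: - Validity: if a process decides $v$, then some process proposed $v$ (has input $v$). - Agreement: no two processes decide differently. - COF Termination: in every infinite execution, for every correct process $p$ with input $v$, if there is a suffix of the execution in which no process whose input differs from $v$ takes steps of its $\textit{propose}$ operation, then $p$ decides. (COF Termination is the conflict-obstruction-freedom progress condition for the consensus object, in which $\textit{propose}(v)$ and $\textit{propose}(v')$ conflict if and only if $v\ne v'$.) *)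

theory Defs
  imports Main "HOL-Library.Extended_Nat"
begin

text \<open>Processes are the natural numbers below \<open>n\<close>. Binary values are booleans, with
  \<^term>\<open>False\<close> for 0 and \<^term>\<open>True\<close> for 1. Registers, their contents and internal states
  range over arbitrary (possibly infinite) types, and every process may read and write every
  register.\<close>

datatype ('r, 'v) event = Read 'r | Write 'r 'v

text \<open>After returning, a single-shot \<open>propose\<close> takes no more steps, so only its response is
  kept.\<close>

datatype 's local_state = Pending 's | Decided bool

text \<open>Here \<open>start v\<close> is the internal state upon invoking \<open>propose v\<close>, and \<open>access s\<close> is the
  shared-memory event of the step taken in state \<open>s\<close>. The second argument of \<open>update\<close> is the
  outcome of that event: \<open>Some x\<close> if it was a read that obtained \<open>x\<close>, and \<open>None\<close> if it was a
  write.\<close>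

record ('s, 'r, 'v) automaton =
  start :: "bool \<Rightarrow> 's"
  access :: "'s \<Rightarrow> ('r, 'v) event"
  update :: "'s \<Rightarrow> 'v option \<Rightarrow> 's local_state"

record ('s, 'r, 'v) algorithm =
  automaton_of :: "nat \<Rightarrow> ('s, 'r, 'v) automaton"
  initial_memory :: "'r \<Rightarrow> 'v"

record ('s, 'r, 'v) config =
  local_states :: "nat \<Rightarrow> 's local_state"
  memory :: "'r \<Rightarrow> 'v"

definition initial_config ::
    "('s, 'r, 'v) algorithm \<Rightarrow> (nat \<Rightarrow> bool) \<Rightarrow> ('s, 'r, 'v) config" where
  "initial_config A inp =
    \<lparr>local_states = (\<lambda>p. Pending (start (automaton_of A p) (inp p))),
     memory = initial_memory A\<rparr>"

inductive step ::
    "nat \<Rightarrow> ('s, 'r, 'v) algorithm \<Rightarrow> nat \<Rightarrow> ('s, 'r, 'v) config \<Rightarrow> ('s, 'r, 'v) config \<Rightarrow> bool"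
  for n A where
  step_read:
    "\<lbrakk>p < n; local_states c p = Pending s; access (automaton_of A p) s = Read r\<rbrakk> \<Longrightarrow>
      step n A p c
        (c\<lparr>local_states :=
             (local_states c)(p := update (automaton_of A p) s (Some (memory c r)))\<rparr>)"
| step_write:
    "\<lbrakk>p < n; local_states c p = Pending s; access (automaton_of A p) s = Write r x\<rbrakk> \<Longrightarrow>
      step n A p c
        (c\<lparr>local_states := (local_states c)(p := update (automaton_of A p) s None),
           memory := (memory c)(r := x)\<rparr>)"

text \<open>An execution with \<open>N\<close> steps, where \<open>N\<close> may be \<open>\<infinity>\<close>: step \<open>i < N\<close> is taken by process
  \<open>sched i\<close> and leads from configuration \<open>C i\<close> to \<open>C (Suc i)\<close>. The values \<open>sched i\<close> for
  \<open>i \<ge> N\<close> and \<open>C i\<close> for \<open>i > N\<close> are irrelevant.\<close>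

definition execution ::
    "nat \<Rightarrow> ('s, 'r, 'v) algorithm \<Rightarrow> (nat \<Rightarrow> bool) \<Rightarrow> enat \<Rightarrow> (nat \<Rightarrow> nat)
      \<Rightarrow> (nat \<Rightarrow> ('s, 'r, 'v) config) \<Rightarrow> bool" where
  "execution n A inp N sched C \<longleftrightarrow>
    C 0 = initial_config A inp \<and>
    (\<forall>i. enat i < N \<longrightarrow> step n A (sched i) (C i) (C (Suc i)))"

definition decides :: "enat \<Rightarrow> (nat \<Rightarrow> ('s, 'r, 'v) config) \<Rightarrow> nat \<Rightarrow> bool \<Rightarrow> bool" where
  "decides N C p v \<longleftrightarrow> (\<exists>i. enat i \<le> N \<and> local_states (C i) p = Decided v)"

text \<open>Only for infinite executions. All operations are pending initially and a returned process
  takes no further steps, so having no pending operation means having returned at some point.\<close>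

definition correct :: "(nat \<Rightarrow> nat) \<Rightarrow> (nat \<Rightarrow> ('s, 'r, 'v) config) \<Rightarrow> nat \<Rightarrow> bool" where
  "correct sched C p \<longleftrightarrow>
    infinite {i. sched i = p} \<or> (\<exists>i. \<nexists>s. local_states (C i) p = Pending s)"

definition validity :: "nat \<Rightarrow> ('s, 'r, 'v) algorithm \<Rightarrow> bool" where
  "validity n A \<longleftrightarrow>
    (\<forall>inp N sched C. execution n A inp N sched C \<longrightarrow>
      (\<forall>p<n. \<forall>v. decides N C p v \<longrightarrow> (\<exists>q<n. inp q = v)))"

definition agreement :: "nat \<Rightarrow> ('s, 'r, 'v) algorithm \<Rightarrow> bool" where
  "agreement n A \<longleftrightarrow>
    (\<forall>inp N sched C. execution n A inp N sched C \<longrightarrow>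
      (\<forall>p<n. \<forall>q<n. \<forall>v w. decides N C p v \<and> decides N C q w \<longrightarrow> v = w))"

definition cof_termination :: "nat \<Rightarrow> ('s, 'r, 'v) algorithm \<Rightarrow> bool" where
  "cof_termination n A \<longleftrightarrow>
    (\<forall>inp sched C. execution n A inp \<infinity> sched C \<longrightarrow>
      (\<forall>p<n. correct sched C p \<and> (\<exists>k. \<forall>i\<ge>k. inp (sched i) = inp p) \<longrightarrow>
        (\<exists>v. decides \<infinity> C p v)))"

definition cof_consensus :: "nat \<Rightarrow> ('s, 'r, 'v) algorithm \<Rightarrow> bool" where
  "cof_consensus n A \<longleftrightarrow> validity n A \<and> agreement n A \<and> cof_termination n A"

end

theory Submission imports Defs begin

text \<open>Give input 1 to process 2 and input 0 to all others, and call the latter the group. By COF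
  Termination the group, running without process 2, cannot run forever from a reachable
  configuration, so it decides there; call a configuration univalent if only one outcome is
  possible. A bivalent reachable configuration would lead, as in the wait-free impossibility proof,
  to a critical one, where two steps of group members fix different outcomes. If all reachable
  configurations are univalent, then the solo run of process 2 contains a step that changes the
  outcome from 0 to 1. Let process 0 run while this step of process 2 would still change the
  outcome: at the last such configuration, the order of the two next steps of processes 0 and 2
  determines the outcome. Both situations are impossible, as for every pair of steps some group
  member cannot tell which came first.\<close>

subsection \<open>Steps\<close>

lemma step_unique: "step n A x c d \<Longrightarrow> step n A x c e \<Longrightarrow> d = e"
  by (auto elim!: step.cases)

lemma step_other: "step n A x c d \<Longrightarrow> y \<noteq> x \<Longrightarrow> local_states d y = local_states c y"
  by (auto elim!: step.cases)

lemma step_pending: "step n A x c d \<Longrightarrow> x < n \<and> (\<exists>s. local_states c x = Pending s)"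
  by (auto elim!: step.cases)

lemma step_exists:
  assumes "x < n" "local_states c x = Pending s"
  shows "\<exists>d. step n A x c d"
  using assms by (cases "access (automaton_of A x) s") (blast intro: step_read step_write)+

lemma step_decided:
  "step n A x c d \<Longrightarrow> local_states c y = Decided v \<Longrightarrow> local_states d y = Decided v"
  by (metis step_other step_pending local_state.distinct(1))

text \<open>Indistinguishability for the processes in \<open>Z\<close>: by
  \<open>step_agree_on\<close>, a run in which only they take steps can be replayed from the other
  configuration.\<close>

definition agree_on ::
    "nat set \<Rightarrow> ('s, 'r, 'v) config \<Rightarrow> ('s, 'r, 'v) config \<Rightarrow> bool" where
  "agree_on Z c d \<longleftrightarrow> memory c = memory d \<and> (\<forall>z\<in>Z. local_states c z = local_states d z)"

lemma step_agree_on: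
  assumes "step n A z c c'" "agree_on Z c d" "z \<in> Z"
  shows "\<exists>d'. step n A z d d' \<and> agree_on Z c' d'"
  using assms(1)
proof cases
  case (step_read s r)
  then have "step n A z d (d\<lparr>local_states := (local_states d)
      (z := update (automaton_of A z) s (Some (memory d r)))\<rparr>)"
    using assms by (intro step.step_read) (auto simp: agree_on_def)
  then show ?thesis using assms step_read by (auto simp: agree_on_def)
next
  case (step_write s r x)
  then have "step n A z d (d\<lparr>local_states := (local_states d)
      (z := update (automaton_of A z) s None), memory := (memory d)(r := x)\<rparr>)"
    using assms by (intro step.step_write) (auto simp: agree_on_def)
  then show ?thesis using assms step_write by (auto simp: agree_on_def)
qed

lemma solo_agree_on:
  assumes "(step n A z)\<^sup>*\<^sup>* c c'" "agree_on Z c d" "z \<in> Z"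
  shows "\<exists>d'. (step n A z)\<^sup>*\<^sup>* d d' \<and> agree_on Z c' d'"
  using assms
proof (induction rule: rtranclp_induct)
  case (step y w)
  then show ?case by (meson rtranclp.rtrancl_into_rtrancl step_agree_on)
qed blast

lemma step_effect:
  assumes "step n A x c d" "local_states c x = Pending s"
  shows "d = (case access (automaton_of A x) s of
      Read r \<Rightarrow> c\<lparr>local_states :=
        (local_states c)(x := update (automaton_of A x) s (Some (memory c r)))\<rparr>
    | Write r v \<Rightarrow> c\<lparr>local_states := (local_states c)(x := update (automaton_of A x) s None),
        memory := (memory c)(r := v)\<rparr>)"
  using assms by cases auto

text \<open>Two reads, or accesses to different registers, commute. On a common register, a write by
  \<open>y\<close> hides an earlier step of \<open>x\<close> from all processes but
  \<open>x\<close>; if \<open>y\<close> reads and \<open>x\<close> writes, the read leaves a trace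
  only in \<open>y\<close>.\<close>

lemma step_diamond:
  assumes "x \<noteq> y" "step n A x c cx" "step n A y cx cxy" "step n A y c cy" "step n A x cy cyx"
  shows "cxy = cyx \<or> agree_on (-{x}) cxy cy \<or> agree_on (-{y}) cyx cx"
proof -
  obtain s where s: "local_states c x = Pending s" using step_pending assms(2) by metis
  obtain t where t: "local_states c y = Pending t" using step_pending assms(4) by metis
  have s': "local_states cy x = Pending s" using step_other[OF assms(4,1)] s by simp
  have t': "local_states cx y = Pending t" using step_other[OF assms(2)] assms(1) t by metis
  note effects = step_effect[OF assms(2) s] step_effect[OF assms(3) t']
    step_effect[OF assms(4) t] step_effect[OF assms(5) s']
  show ?thesis
  proof (cases "access (automaton_of A x) s")
    case x: (Read r)
    show ?thesis
    proof (cases "access (automaton_of A y) t")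
      case (Read r')
      then show ?thesis using x assms(1) unfolding effects by (simp add: fun_upd_twist)
    next
      case (Write r' w)
      then show ?thesis using x assms(1) unfolding effects
        by (cases "r = r'") (simp_all add: fun_upd_twist agree_on_def)
    qed
  next
    case x: (Write r v)
    show ?thesis
    proof (cases "access (automaton_of A y) t")
      case (Read r')
      then show ?thesis using x assms(1) unfolding effects
        by (cases "r = r'") (simp_all add: fun_upd_twist agree_on_def)
    next
      case (Write r' w)
      then show ?thesis using x assms(1) unfolding effects
        by (cases "r = r'") (simp_all add: fun_upd_twist agree_on_def)
    qed
  qed
qed

subsection \<open>Reachable configurations\<close>

definition group_step ::
    "nat \<Rightarrow> ('s, 'r, 'v) algorithm \<Rightarrow> nat set \<Rightarrow> ('s, 'r, 'v) config \<Rightarrow> ('s, 'r, 'v) config \<Rightarrow> bool"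
  where "group_step n A P c d \<longleftrightarrow> (\<exists>x\<in>P. step n A x c d)"

definition reachable ::
    "nat \<Rightarrow> ('s, 'r, 'v) algorithm \<Rightarrow> (nat \<Rightarrow> bool) \<Rightarrow> ('s, 'r, 'v) config \<Rightarrow> bool" where
  "reachable n A inp c \<longleftrightarrow> (group_step n A UNIV)\<^sup>*\<^sup>* (initial_config A inp) c"

lemma reachable_step: "reachable n A inp c \<Longrightarrow> step n A x c d \<Longrightarrow> reachable n A inp d"
  unfolding reachable_def
  by (erule rtranclp.rtrancl_into_rtrancl) (auto simp: group_step_def)

lemma reachable_group:
  assumes "(group_step n A P)\<^sup>*\<^sup>* c d" "reachable n A inp c"
  shows "reachable n A inp d"
  using assms by (induction rule: rtranclp_induct) (auto simp: group_step_def dest: reachable_step)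

lemma reachable_initial: "reachable n A inp (initial_config A inp)"
  by (simp add: reachable_def)

lemma solo_imp_group: "(step n A z)\<^sup>*\<^sup>* c d \<Longrightarrow> z \<in> P \<Longrightarrow> (group_step n A P)\<^sup>*\<^sup>* c d"
  by (erule rtranclp_mono[THEN predicate2D, rotated]) (auto simp: group_step_def)

lemma group_decided:
  assumes "(group_step n A P)\<^sup>*\<^sup>* c d" "local_states c y = Decided v"
  shows "local_states d y = Decided v"
  using assms by (induction rule: rtranclp_induct) (auto simp: group_step_def dest: step_decided)

lemma reachable_path:
  assumes "reachable n A inp c"
  obtains C m sched where "C 0 = initial_config A inp" "C m = c"
    "\<forall>i<m. step n A (sched i) (C i) (C (Suc i))"
proof -
  from assms obtain m where "(group_step n A UNIV ^^ m) (initial_config A inp) c"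
    unfolding reachable_def using rtranclp_imp_relpowp by metis
  then obtain C where C: "C 0 = initial_config A inp" "C m = c"
    "\<forall>i<m. \<exists>x. step n A x (C i) (C (Suc i))"
    by (auto simp: relpowp_fun_conv group_step_def)
  then obtain sched where "\<forall>i<m. step n A (sched i) (C i) (C (Suc i))"
    by metis
  with C that show ?thesis by blast
qed

lemma reachable_execution:
  assumes "reachable n A inp c"
  obtains m sched C where "execution n A inp (enat m) sched C" "C m = c"
  using reachable_path[OF assms] unfolding execution_def by (metis enat_ord_simps(2))

lemma reachable_agreement:
  assumes "agreement n A" "reachable n A inp c" "p < n" "q < n"
    "local_states c p = Decided v" "local_states c q = Decided w"
  shows "v = w"
proof -
  obtain m sched C where *: "execution n A inp (enat m) sched C" "C m = c"
    using reachable_execution[OF assms(2)] .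
  then have "decides (enat m) C p v" "decides (enat m) C q w"
    using assms unfolding decides_def by blast+
  then show ?thesis using assms * unfolding agreement_def by blast
qed

lemma reachable_validity:
  assumes "validity n A" "reachable n A inp c" "p < n" "local_states c p = Decided v"
  shows "\<exists>q<n. inp q = v"
proof -
  obtain m sched C where *: "execution n A inp (enat m) sched C" "C m = c"
    using reachable_execution[OF assms(2)] .
  then have "decides (enat m) C p v"
    using assms unfolding decides_def by blast
  then show ?thesis using assms * unfolding validity_def by blast
qed

text \<open>By pigeonhole some process takes infinitely many steps, so its input is \<open>b\<close>
  and COF Termination makes it decide; but a process that has decided takes no further step.\<close>

lemma no_eventually_uniform_execution:
  assumes "cof_termination n A" "execution n A inp \<infinity> sched C" "\<And>i. i \<ge> k \<Longrightarrow> inp (sched i) = b"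
  shows False
proof -
  have st: "step n A (sched i) (C i) (C (Suc i))" for i
    using assms(2) by (simp add: execution_def)
  have "range sched \<subseteq> {..<n}" using st step_pending by blast
  then have "finite (range sched)" using finite_subset by blast
  then obtain p where p: "infinite {i. sched i = p}"
    using pigeonhole_infinite[of UNIV sched] by (auto simp: infinite_UNIV_nat)
  have ex: "\<exists>i\<ge>j. sched i = p" for j
    using p by (auto simp: infinite_nat_iff_unbounded_le)
  have "p < n" using ex[of 0] st step_pending by blast
  moreover have "inp p = b" using ex[of k] assms(3) by blast
  ultimately obtain v where "decides \<infinity> C p v"
    using assms p unfolding cof_termination_def correct_def by metis
  then obtain i where i: "local_states (C i) p = Decided v" by (auto simp: decides_def)
  have "local_states (C j) p = Decided v" if "j \<ge> i" for j
    using that by (induction rule: dec_induct) (use i st step_decided in blast)+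
  then show False using ex[of i] st step_pending by (metis local_state.distinct(1))
qed

text \<open>Provides induction in which a configuration is treated after its successors under group
  steps. An infinite chain, preceded by a path to its first configuration, would be an execution
  whose steps are eventually all by processes with input \<open>b\<close>.\<close>

lemma wfp_group_step:
  assumes "cof_termination n A" "P \<subseteq> {x. inp x = b}"
  shows "wfp (\<lambda>d c. reachable n A inp c \<and> group_step n A P c d)"
proof (rule ccontr)
  assume "\<not> ?thesis"
  then obtain f where f: "\<And>i. reachable n A inp (f i)" "\<And>i. group_step n A P (f i) (f (Suc i))"
    unfolding wfp_def wf_iff_no_infinite_down_chain by auto
  have "\<exists>x. inp x = b \<and> step n A x (f i) (f (Suc i))" for i
    using f(2)[of i] assms(2) by (auto simp: group_step_def)
  then obtain g where g: "\<And>i. inp (g i) = b" "\<And>i. step n A (g i) (f i) (f (Suc i))"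
    by metis
  obtain C m sched where C: "C 0 = initial_config A inp" "C m = f 0"
    "\<forall>i<m. step n A (sched i) (C i) (C (Suc i))"
    using reachable_path[OF f(1)[of 0]] .
  let ?C = "\<lambda>i. if i < m then C i else f (i - m)"
  let ?s = "\<lambda>i. if i < m then sched i else g (i - m)"
  have "step n A (?s i) (?C i) (?C (Suc i))" for i
  \<comment> \<open>At the seam, the last step of the finite path ends in \<open>C m\<close>, which
    is \<open>f 0\<close>.\<close>
  proof (cases "Suc i = m")
    case True
    then show ?thesis using C(2) C(3)[rule_format, of i] by auto
  next
    case False
    then show ?thesis using C(3)[rule_format, of i] g(2)[of "i - m"] by (auto simp: Suc_diff_le)
  qed
  moreover have "?C 0 = initial_config A inp" using C by auto
  ultimately have "execution n A inp \<infinity> ?s ?C" unfolding execution_def by blast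
  then show False
    by (rule no_eventually_uniform_execution[OF assms(1), where k = m and b = b]) (use g in auto)
qed

lemma solo_decides:
  assumes "cof_termination n A" "reachable n A inp c" "z < n"
  shows "\<exists>d v. (step n A z)\<^sup>*\<^sup>* c d \<and> local_states d z = Decided v"
proof -
  \<comment> \<open>A single process forms a group with equal inputs, so \<open>b\<close> is
    \<open>inp z\<close>.\<close>
  have "wfp (\<lambda>d c. reachable n A inp c \<and> group_step n A {z} c d)"
    using wfp_group_step[OF assms(1)] by blast
  then show ?thesis using assms(2)
  proof (induction c rule: wfp_induct_rule)
    case (less c)
    show ?case
    proof (cases "local_states c z")
      case (Pending s)
      then obtain d where "step n A z c d" using step_exists assms(3) by metis
      then show ?thesis using less
        by (metis converse_rtranclp_into_rtranclp group_step_def insertI1 reachable_step)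
    qed blast
  qed
qed

text \<open>In its solo run, a process cannot exclude that all inputs equal its own.\<close>

lemma solo_decides_own_input:
  assumes "cof_consensus n A" "z < n"
  shows "\<exists>d. (step n A z)\<^sup>*\<^sup>* (initial_config A inp) d \<and> local_states d z = Decided (inp z)"
proof -
  have A: "validity n A" "cof_termination n A" using assms by (auto simp: cof_consensus_def)
  obtain d v where d: "(step n A z)\<^sup>*\<^sup>* (initial_config A inp) d" "local_states d z = Decided v"
    using solo_decides[OF A(2) reachable_initial assms(2)] by blast
  have "agree_on {z} (initial_config A inp) (initial_config A (\<lambda>_. inp z))"
    by (simp add: agree_on_def initial_config_def)
  then obtain d' where d': "(step n A z)\<^sup>*\<^sup>* (initial_config A (\<lambda>_. inp z)) d'" "agree_on {z} d d'"
    using solo_agree_on[OF d(1)] by blast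
  have "reachable n A (\<lambda>_. inp z) d'"
    using reachable_group[OF solo_imp_group[OF d'(1) UNIV_I] reachable_initial] .
  moreover have "local_states d' z = Decided v"
    using d(2) d'(2) by (simp add: agree_on_def)
  ultimately have "inp z = v"
    using reachable_validity[OF A(1) _ assms(2)] by metis
  then show ?thesis using d by blast
qed

subsection \<open>Valence with respect to a group of processes with equal inputs\<close>

locale cof_group =
  fixes n :: nat and A :: "('s, 'r, 'v) algorithm" and inp :: "nat \<Rightarrow> bool"
    and P :: "nat set" and b :: bool
  assumes consensus: "cof_consensus n A"
    and inputs: "P \<subseteq> {x. inp x = b}"
begin

abbreviation reach :: "('s, 'r, 'v) config \<Rightarrow> bool" where
  "reach \<equiv> reachable n A inp"

text \<open>Only members of \<open>P\<close> take steps, but decisions of all processes count,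
  including one made earlier by an outsider.\<close>

definition can_decide :: "('s, 'r, 'v) config \<Rightarrow> bool \<Rightarrow> bool" where
  "can_decide c v \<longleftrightarrow>
    (\<exists>d x. (group_step n A P)\<^sup>*\<^sup>* c d \<and> x < n \<and> local_states d x = Decided v)"

abbreviation univalent :: "bool \<Rightarrow> ('s, 'r, 'v) config \<Rightarrow> bool" where
  "univalent v c \<equiv> can_decide c v \<and> \<not> can_decide c (\<not> v)"

lemma cof_terminates: "cof_termination n A" and agrees: "agreement n A"
  using consensus by (auto simp: cof_consensus_def)

lemma can_decide_back:
  assumes "can_decide d v" "step n A x c d" "x \<in> P"
  shows "can_decide c v"
proof -
  have "group_step n A P c d" using assms by (auto simp: group_step_def)
  then show ?thesis
    using assms(1) unfolding can_decide_def by (metis converse_rtranclp_into_rtranclp)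
qed

text \<open>The decision of \<open>x\<close> persists along the group run, so Agreement ties every
  decision reached there to it.\<close>

lemma can_decide_decided:
  assumes "reach c" "x < n" "local_states c x = Decided v" "can_decide c w"
  shows "w = v"
  using assms(4) unfolding can_decide_def
  by (metis reachable_agreement[OF agrees] reachable_group group_decided assms(1-3))

lemma solo_can_decide:
  assumes "(step n A z)\<^sup>*\<^sup>* c d" "z \<in> P" "z < n" "local_states d z = Decided v"
  shows "can_decide c v"
  unfolding can_decide_def using solo_imp_group assms by metis

lemma can_decide_some:
  assumes "reach c" "z \<in> P" "z < n"
  shows "\<exists>v. can_decide c v"
  using solo_decides[OF cof_terminates assms(1,3)] solo_can_decide assms by metis

text \<open>The solo run in which \<open>z\<close> decides from \<open>c\<close> can be replayed
  from \<open>d\<close>, where \<open>z\<close> decides the same.\<close>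

lemma agree_on_common_value:
  assumes "agree_on Z c d" "reach c" "z \<in> Z" "z \<in> P" "z < n"
  shows "\<exists>v. can_decide c v \<and> can_decide d v"
proof -
  obtain c' v where c': "(step n A z)\<^sup>*\<^sup>* c c'" "local_states c' z = Decided v"
    using solo_decides[OF cof_terminates assms(2,5)] by blast
  moreover obtain d' where "(step n A z)\<^sup>*\<^sup>* d d'" "agree_on Z c' d'"
    using solo_agree_on[OF c'(1) assms(1,3)] by blast
  ultimately show ?thesis
    using solo_can_decide assms unfolding agree_on_def by metis
qed

text \<open>Each case of \<open>step_diamond\<close> compares two configurations with opposite
  outcomes that are equal or look alike to all processes but one. A group member other than that one
  can decide the same value from both. Neither \<open>x\<close> nor \<open>y\<close> has to be in
  the group, so this covers critical configurations and steps of outsiders alike.\<close>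

lemma step_order_not_decisive:
  assumes "reach c" "x \<noteq> y"
    and "step n A x c cx" "step n A y cx cxy" "step n A y c cy" "step n A x cy cyx"
    and "univalent v cx" "univalent v cxy" "univalent (\<not> v) cy" "univalent (\<not> v) cyx"
    and "\<And>w. \<exists>z\<in>P. z < n \<and> z \<noteq> w"
  shows False
proof -
  have r: "reach cxy" "reach cyx" using assms reachable_step by metis+
  consider "cxy = cyx" | "agree_on (-{x}) cxy cy" | "agree_on (-{y}) cyx cx"
    using step_diamond[OF assms(2-6)] by blast
  then show False
  proof cases
    case 1
    then show ?thesis using assms by blast
  next
    case 2
    obtain z where "z \<in> P" "z < n" "z \<in> -{x}" using assms(11)[of x] by blast
    then obtain u where "can_decide cxy u" "can_decide cy u"
      using agree_on_common_value[OF 2 r(1)] by blast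
    then show ?thesis using assms by (cases "u = v") auto
  next
    case 3
    obtain z where "z \<in> P" "z < n" "z \<in> -{y}" using assms(11)[of y] by blast
    then obtain u where "can_decide cyx u" "can_decide cx u"
      using agree_on_common_value[OF 3 r(2)] by blast
    then show ?thesis using assms by (cases "u = v") auto
  qed
qed

section \<open>Valence along steps of the group and of an outsider\<close>

lemma univalent_step:
  assumes "univalent v c" "reach c" "step n A x c d" "x \<in> P"
  shows "univalent v d"
proof -
  obtain w where w: "can_decide d w"
    using can_decide_some[OF reachable_step[OF assms(2,3)] assms(4)] step_pending[OF assms(3)]
    by blast
  have "\<not> can_decide d (\<not> v)" using can_decide_back[OF _ assms(3,4)] assms(1) by blast
  with w show ?thesis by (cases "w = v") auto
qed

lemma swapped_step:
  assumes "step n A x c d" "step n A y c e" "x \<noteq> y"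
  obtains f where "step n A y d f"
  using assms step_exists step_other step_pending by metis

text \<open>By induction, no successor under a group step is bivalent. A bivalent \<open>c\<close>
  would thus be critical: two group steps lead to opposite outcomes.\<close>

lemma not_bivalent:
  assumes two: "\<And>w. \<exists>z\<in>P. z < n \<and> z \<noteq> w" and "reach c"
  shows "\<not> (can_decide c v \<and> can_decide c (\<not> v))"
  using wfp_group_step[OF cof_terminates inputs] assms(2)
proof (induction c rule: wfp_induct_rule)
  case (less c)
  show ?case
  proof
    assume biv: "can_decide c v \<and> can_decide c (\<not> v)"
    \<comment> \<open>A run from \<open>c\<close> to a decision on \<open>u\<close> is nonempty, as
      a decision already made in \<open>c\<close> would rule out the other value. Its first step
      still allows \<open>u\<close>, and the induction hypothesis excludes the opposite.\<close>
    have first: "\<exists>x\<in>P. \<exists>d. step n A x c d \<and> univalent u d"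
      if cd: "can_decide c u" for u
    proof -
      obtain d x where d: "(group_step n A P)\<^sup>*\<^sup>* c d" "x < n" "local_states d x = Decided u"
        using cd by (auto simp: can_decide_def)
      have "c \<noteq> d"
        using can_decide_decided[OF less.prems] d biv by metis
      from d(1) obtain e where e: "group_step n A P c e" "(group_step n A P)\<^sup>*\<^sup>* e d"
        by (rule converse_rtranclpE) (use \<open>c \<noteq> d\<close> in blast)+
      then have "can_decide e u" using d by (auto simp: can_decide_def)
      moreover have "reach e" using e less.prems by (auto simp: group_step_def dest: reachable_step)
      ultimately have "univalent u e" using less.IH[of e] less.prems e by (cases "u = v") auto
      then show ?thesis using e by (auto simp: group_step_def)
    qed
    obtain x cx where x: "x \<in> P" "step n A x c cx" "univalent v cx"
      using first biv by blast
    obtain y cy where y: "y \<in> P" "step n A y c cy" "univalent (\<not> v) cy"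
      using first[of "\<not> v"] biv by blast
    \<comment> \<open>One process has only one next configuration, which cannot have both
      outcomes.\<close>
    have "x \<noteq> y" using x y step_unique by metis
    obtain cxy where xy: "step n A y cx cxy" using swapped_step x y \<open>x \<noteq> y\<close> by metis
    obtain cyx where yx: "step n A x cy cyx" using swapped_step x y \<open>x \<noteq> y\<close> by metis
    have "univalent v cxy" using univalent_step[OF x(3) _ xy y(1)] reachable_step less.prems x by metis
    moreover have "univalent (\<not> v) cyx"
      using univalent_step[OF y(3) _ yx x(1)] reachable_step less.prems y by metis
    ultimately show False
      using step_order_not_decisive[OF less.prems \<open>x \<noteq> y\<close> x(2) xy y(2) yx] x y two by blast
  qed
qed

text \<open>If the step of \<open>r\<close> changed the outcome at \<open>c\<close>, let a group
  member \<open>p\<close> move first: by the induction hypothesis the step of \<open>r\<close> then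
  preserves the outcome. So the order of \<open>p\<close> and \<open>r\<close> would be
  decisive.\<close>

lemma outside_step_preserves_valence:
  assumes two: "\<And>w. \<exists>z\<in>P. z < n \<and> z \<noteq> w"
    and "reach c" "r \<notin> P" "univalent v c" "step n A r c d"
  shows "univalent v d"
  using wfp_group_step[OF cof_terminates inputs] assms(2,4,5)
proof (induction c arbitrary: d rule: wfp_induct_rule)
  case (less c)
  obtain p where p: "p \<in> P" "p < n" using two by blast
  have rd: "reach d" using less.prems reachable_step by metis
  show ?case
  proof (rule ccontr)
    assume neg: "\<not> univalent v d"
    obtain u where "can_decide d u" using can_decide_some[OF rd p] by blast
    then have d: "univalent (\<not> v) d"
      using neg not_bivalent[OF two rd, of v] by (cases "u = v") auto
    \<comment> \<open>A decision of \<open>p\<close> in \<open>c\<close> would persist in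
      \<open>d\<close> and force the same outcome in both.\<close>
    have "local_states c p \<noteq> Decided u" for u
      using can_decide_decided[OF less.prems(1) p(2)] can_decide_decided[OF rd p(2)]
        step_decided[OF less.prems(3)] less.prems(2) d by metis
    then obtain e where e: "step n A p c e"
      using step_exists[OF p(2)] by (metis local_state.exhaust)
    have re: "reach e" using e less.prems reachable_step by metis
    have ue: "univalent v e" using univalent_step less.prems e p by metis
    have "p \<noteq> r" using p assms(3) by blast
    obtain er where er: "step n A r e er" using swapped_step e less.prems(3) \<open>p \<noteq> r\<close> by metis
    obtain dp where dp: "step n A p d dp" using swapped_step e less.prems(3) \<open>p \<noteq> r\<close> by metis
    have "univalent v er"
      using less.IH[OF _ re ue er] less.prems(1) e p by (auto simp: group_step_def)
    moreover have "univalent (\<not> v) dp" using univalent_step[OF d rd dp p(1)] .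
    ultimately show False
      using step_order_not_decisive[OF less.prems(1) \<open>p \<noteq> r\<close> e er less.prems(3) dp] ue d two
      by blast
  qed
qed

end

theorem theorem6:
  fixes n :: nat
  assumes "n \<ge> 3"
  shows "\<not> (\<exists>A :: ('s, 'r, 'v) algorithm. cof_consensus n A)"
proof
  assume "\<exists>A :: ('s, 'r, 'v) algorithm. cof_consensus n A"
  then obtain A :: "('s, 'r, 'v) algorithm" where A: "cof_consensus n A" by blast
  \<comment> \<open>Two group members 0 and 1 suffice, since one remains when any process is
    excluded; \<open>n \<ge> 3\<close> makes the dissenter 2 a process.\<close>
  define inp where "inp = (\<lambda>x::nat. x = 2)"
  interpret cof_group n A inp "{0, 1}" False
    by unfold_locales (use A in \<open>auto simp: inp_def\<close>)
  have two: "\<exists>z\<in>{0, 1}. z < n \<and> z \<noteq> w" for w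
    using assms by (cases "w = 0") auto
  let ?c = "initial_config A inp"
  have "can_decide ?c False"
    using solo_decides_own_input[OF A, of 0 inp] solo_can_decide[of 0 ?c] assms
    by (auto simp: inp_def)
  then have init: "univalent False ?c"
    using not_bivalent[OF two reachable_initial, of False] by auto
  obtain d where d: "(step n A 2)\<^sup>*\<^sup>* ?c d" "local_states d 2 = Decided True"
    using solo_decides_own_input[OF A, of 2 inp] assms by (auto simp: inp_def)
  \<comment> \<open>The outcome \<open>False\<close> survives every step of process 2, up to the
    configuration in which it has decided \<open>True\<close>.\<close>
  from d(1) have "reach d \<and> univalent False d"
  proof (induction rule: rtranclp_induct)
    case base
    then show ?case using init reachable_initial by blast
  next
    case (step y z)
    then show ?case
      using outside_step_preserves_valence[OF two, of y 2 False z] reachable_step[of n A inp y 2 z]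
      by auto
  qed
  then show False
    using can_decide_decided[of d 2 True False] d(2) assms by auto
qed

end
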